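(* Let $A\to B$ be an extension of domains (containing $\mathbb{Q}$). If $I$ is a central ideal of $B$, then $I\cap A$ is a central ideal of $A$. In particular, denoting by $\text{C-Spec}\,R$ the set of central prime ideals of a domain $R$, the map $\text{C-Spec}\,B\to\text{C-Spec}\,A$, $\mathfrak q\mapsto\mathfrak q\cap A$, is well defined.
   Context: An extension $A\to B$ is an injective homomorphism of commutative rings, and $A$ is identified with its image in $B$. For a domain $A$ with fraction field $\mathcal{K}(A)$, $\sum\mathcal{K}(A)^2$ is the set of finite sums of squares in $\mathcal{K}(A)$, and an ideal $I$ of $A$ is central if for every $a\in A$ and every $b\in\sum\mathcal{K}(A)^2$, $a^2+b\in I$ implies $a\in I$. *)

theory Defs
  imports "HOL-Algebra.Algebraic_Closure_Type" "HOL-Library.FuncSet"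
begin

text \<open>
  A commutative ring is a type of class \<open>comm_ring_1\<close>, a domain a type of class \<open>idom\<close>;
  the fraction field of the domain \<open>'a\<close> is \<open>'a fract\<close>, in which \<open>'a\<close> sits via \<open>to_fract\<close>.
  The library constant \<open>ring_of_type_algebra\<close> turns a type into an HOL-Algebra ring with
  carrier \<open>UNIV\<close>, so that \<open>ideal\<close>, \<open>primeideal\<close> and \<open>ring_hom\<close> apply.
\<close>

definition ring_extension :: "('a::comm_ring_1 \<Rightarrow> 'b::comm_ring_1) \<Rightarrow> bool" where
  "ring_extension f \<longleftrightarrow> f \<in> ring_hom ring_of_type_algebra ring_of_type_algebra \<and> inj f"

definition sums_of_squares :: "'k::field set" where
  "sums_of_squares = range (\<lambda>xs. \<Sum>x\<leftarrow>xs. x ^ 2)"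

text \<open>
  The element \<open>b\<close> ranges over the fraction field, so \<open>a\<^sup>2 + b \<in> I\<close> is read there; in particular
  it forces \<open>b\<close> to lie in (the image of) the domain.
\<close>

definition central_ideal :: "'a::idom set \<Rightarrow> bool" where
  "central_ideal I \<longleftrightarrow> ideal I ring_of_type_algebra \<and>
     (\<forall>a. \<forall>b \<in> (sums_of_squares :: 'a fract set).
        to_fract a ^ 2 + b \<in> to_fract ` I \<longrightarrow> a \<in> I)"

definition C_Spec :: "'a::idom set set" where
  "C_Spec = {p. primeideal p ring_of_type_algebra \<and> central_ideal p}"

end

theory Submission
  imports Defs
begin

text \<open>
  Over a common denominator \<open>d\<close> in the smaller domain, the relation \<open>a\<^sup>2 + b = i\<close> in the fraction
  field becomes \<open>(a d)\<^sup>2 + \<Sum>x\<^sub>k\<^sup>2 = i d\<^sup>2\<close>, an identity inside that domain. It is carried over by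
  the injection \<open>f\<close> and divided by \<open>(f d)\<^sup>2\<close>, so centrality of \<open>I\<close> applies to \<open>f a\<close> directly and the
  induced map of fraction fields is never needed.
\<close>

lemma to_fract_sum_list_power2: "to_fract (\<Sum>x\<leftarrow>xs. x\<^sup>2) = (\<Sum>x\<leftarrow>xs. (to_fract x)\<^sup>2)"
  by (induction xs) (simp_all add: power2_eq_square)

text \<open>Applied in the fraction field, once with a common denominator as \<open>c\<close> and
  once with its inverse, to pass between fractions and their numerators.\<close>

lemma sum_list_power2_scale:
  fixes c :: "'k::comm_semiring_1"
  shows "(\<Sum>x\<leftarrow>map ((*) c) xs. x\<^sup>2) = c\<^sup>2 * (\<Sum>x\<leftarrow>xs. x\<^sup>2)"
  by (induction xs) (simp_all add: algebra_simps power_mult_distrib)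

lemma common_denominator:
  fixes ys :: "'a::idom fract list"
  obtains d xs where "d \<noteq> 0" and "map to_fract xs = map ((*) (to_fract d)) ys"
proof -
  have "\<exists>d xs. d \<noteq> 0 \<and> map to_fract xs = map ((*) (to_fract d)) ys"
  proof (induction ys)
    case Nil
    show ?case by (rule exI[of _ 1]) simp
  next
    case (Cons y ys)
    then obtain d xs where d: "d \<noteq> 0" "map to_fract xs = map ((*) (to_fract d)) ys"
      by blast
    obtain p q where y: "y = to_fract p / to_fract q" "q \<noteq> 0"
      by (cases y) (simp add: Fract_conv_to_fract)
    \<comment> \<open>The new common denominator is \<open>q * d\<close>: the old numerators gain
      the factor \<open>q\<close>, and \<open>y = p/q\<close> contributes
      \<open>d * p\<close>.\<close>
    have "map to_fract (map ((*) q) xs) = map ((*) (to_fract q)) (map to_fract xs)"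
      by simp
    also have "\<dots> = map ((*) (to_fract (q * d))) ys"
      by (simp add: d(2) mult.assoc)
    finally have "map to_fract (d * p # map ((*) q) xs) = map ((*) (to_fract (q * d))) (y # ys)"
      using y by simp
    then show ?case
      using d(1) y(2) by (metis mult_eq_0_iff)
  qed
  then show thesis
    using that by blast
qed

text \<open>Scaling every root by \<open>d\<close> scales the sum by the square of \<open>d\<close>,
  so a square denominator can be cleared or restored without leaving the sums of squares.\<close>

lemma sums_of_squares_fract_iff:
  fixes b :: "'a::idom fract"
  shows "b \<in> sums_of_squares \<longleftrightarrow>
    (\<exists>d xs. d \<noteq> 0 \<and> b * (to_fract d)\<^sup>2 = to_fract (\<Sum>x\<leftarrow>xs. x\<^sup>2))"
proof
  assume "b \<in> sums_of_squares"
  then obtain ys where b: "b = (\<Sum>y\<leftarrow>ys. y\<^sup>2)"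
    by (auto simp: sums_of_squares_def)
  obtain d xs where d: "d \<noteq> 0" "map to_fract xs = map ((*) (to_fract d)) ys"
    by (rule common_denominator)
  have "to_fract (\<Sum>x\<leftarrow>xs. x\<^sup>2) = (\<Sum>x\<leftarrow>map to_fract xs. x\<^sup>2)"
    by (simp add: to_fract_sum_list_power2 o_def)
  also have "\<dots> = b * (to_fract d)\<^sup>2"
    unfolding d(2) sum_list_power2_scale b by (rule mult.commute)
  finally show "\<exists>d xs. d \<noteq> 0 \<and> b * (to_fract d)\<^sup>2 = to_fract (\<Sum>x\<leftarrow>xs. x\<^sup>2)"
    using d(1) by metis
next
  assume "\<exists>d xs. d \<noteq> 0 \<and> b * (to_fract d)\<^sup>2 = to_fract (\<Sum>x\<leftarrow>xs. x\<^sup>2)"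
  then obtain d xs where d: "d \<noteq> 0" "b * (to_fract d)\<^sup>2 = to_fract (\<Sum>x\<leftarrow>xs. x\<^sup>2)"
    by blast
  \<comment> \<open>The roots of \<open>b\<close> are the fractions \<open>x/d\<close> for
    \<open>x\<close> in \<open>xs\<close>.\<close>
  have "(\<Sum>y\<leftarrow>map ((*) (inverse (to_fract d))) (map to_fract xs). y\<^sup>2) =
      (inverse (to_fract d))\<^sup>2 * (b * (to_fract d)\<^sup>2)"
    unfolding sum_list_power2_scale d(2) to_fract_sum_list_power2 by (simp add: o_def)
  also have "\<dots> = b"
    using d(1) by (simp add: field_simps)
  finally show "b \<in> sums_of_squares"
    unfolding sums_of_squares_def by (metis rangeI)
qed

lemma central_ideal_iff:
  fixes I :: "'a::idom set"
  shows "central_ideal I \<longleftrightarrow> ideal I ring_of_type_algebra \<and>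
    (\<forall>a d i xs. d \<noteq> 0 \<longrightarrow> i \<in> I \<longrightarrow> (a * d)\<^sup>2 + (\<Sum>x\<leftarrow>xs. x\<^sup>2) = i * d\<^sup>2 \<longrightarrow> a \<in> I)"
proof -
  \<comment> \<open>The conclusion \<open>a \<in> I\<close> involves only \<open>a\<close>, so it
    suffices to compare the two premises with their other variables bound existentially.\<close>
  have *: "(\<exists>b\<in>sums_of_squares. (to_fract a)\<^sup>2 + b \<in> to_fract ` I) \<longleftrightarrow>
      (\<exists>d i xs. d \<noteq> 0 \<and> i \<in> I \<and> (a * d)\<^sup>2 + (\<Sum>x\<leftarrow>xs. x\<^sup>2) = i * d\<^sup>2)" for a
  proof -
    have eq: "(to_fract i - (to_fract a)\<^sup>2) * (to_fract d)\<^sup>2 = to_fract s \<longleftrightarrow>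
        (a * d)\<^sup>2 + s = i * d\<^sup>2" for i d s :: 'a
    proof -
      have "(to_fract i - (to_fract a)\<^sup>2) * (to_fract d)\<^sup>2 = to_fract ((i - a\<^sup>2) * d\<^sup>2)"
        by (simp add: power2_eq_square)
      then have "(to_fract i - (to_fract a)\<^sup>2) * (to_fract d)\<^sup>2 = to_fract s \<longleftrightarrow>
          (i - a\<^sup>2) * d\<^sup>2 = s"
        by (simp only: to_fract_eq_iff)
      then show ?thesis
        by (auto simp: algebra_simps power_mult_distrib)
    qed
    \<comment> \<open>For fixed \<open>a\<close>, the elements \<open>b\<close> and \<open>i\<close>
      determine each other, so \<open>b\<close> is traded for \<open>i\<close> minus the square of
      \<open>a\<close>.\<close>
    have "(\<exists>b\<in>sums_of_squares. (to_fract a)\<^sup>2 + b \<in> to_fract ` I) \<longleftrightarrow>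
        (\<exists>i\<in>I. to_fract i - (to_fract a)\<^sup>2 \<in> sums_of_squares)"
      by (metis (no_types, lifting) add_diff_cancel_left' diff_add_cancel add.commute imageE imageI)
    then show ?thesis
      unfolding sums_of_squares_fract_iff eq by blast
  qed
  then show ?thesis
    unfolding central_ideal_def by blast
qed

context
  fixes f :: "'a::comm_ring_1 \<Rightarrow> 'b::comm_ring_1"
  assumes f: "ring_extension f"
begin

lemma ring_extension_hom_ring: "ring_hom_ring ring_of_type_algebra ring_of_type_algebra f"
  using f by (intro ring_hom_ringI2) (auto simp: ring_extension_def)

lemma ring_extension_add: "f (x + y) = f x + f y"
  and ring_extension_mult: "f (x * y) = f x * f y"
  using ring_hom_add[of f ring_of_type_algebra ring_of_type_algebra x y]
    ring_hom_mult[of f ring_of_type_algebra ring_of_type_algebra x y] f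
  by (auto simp: ring_extension_def ring_of_type_algebra_def)

lemma ring_extension_zero: "f 0 = 0"
  using ring_extension_add[of 0 0] by simp

text \<open>This is where injectivity enters: it keeps denominators nonzero in the larger
  domain.\<close>

lemma ring_extension_eq_0_iff: "f x = 0 \<longleftrightarrow> x = 0"
  using f inj_eq[of f x 0] by (simp add: ring_extension_def ring_extension_zero)

lemma ring_extension_sum_list: "f (sum_list xs) = (\<Sum>x\<leftarrow>xs. f x)"
  by (induction xs) (simp_all add: ring_extension_add ring_extension_zero)

lemma ideal_vimage_ring_extension:
  "ideal I ring_of_type_algebra \<Longrightarrow> ideal (f -` I) ring_of_type_algebra"
  using ring_hom_ring.ideal_vimage[OF ring_extension_hom_ring]
  by (simp add: ring_of_type_algebra_def vimage_def)

text \<open>The preimage stays proper because \<open>f\<close> sends 1 to 1, and primality pulls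
  back through multiplicativity.\<close>

lemma primeideal_vimage_ring_extension:
  "primeideal I ring_of_type_algebra \<Longrightarrow> primeideal (f -` I) ring_of_type_algebra"
  using ring_hom_ring.primeideal_vimage[OF ring_extension_hom_ring]
    cring_from_type_algebra[where 'a='a]
  by (simp add: ring_of_type_algebra_def vimage_def)

end

lemma central_ideal_vimage:
  fixes f :: "'a::idom \<Rightarrow> 'b::idom"
  assumes f: "ring_extension f" and I: "central_ideal I"
  shows "central_ideal (f -` I)"
  unfolding central_ideal_iff
proof (intro conjI allI impI)
  show "ideal (f -` I) ring_of_type_algebra"
    using I ideal_vimage_ring_extension[OF f] by (simp add: central_ideal_iff)
next
  fix a d i :: 'a and xs :: "'a list"
  assume "d \<noteq> 0" "i \<in> f -` I" and eq: "(a * d)\<^sup>2 + (\<Sum>x\<leftarrow>xs. x\<^sup>2) = i * d\<^sup>2"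
  \<comment> \<open>A homomorphism preserves the shape of the identity: \<open>f d\<close>,
    \<open>f i\<close> and \<open>map f xs\<close> now witness the premise for
    \<open>f a\<close>.\<close>
  have "(f a * f d)\<^sup>2 + (\<Sum>y\<leftarrow>map f xs. y\<^sup>2) = f i * (f d)\<^sup>2"
    using arg_cong[OF eq, of f]
    by (simp add: ring_extension_add[OF f] ring_extension_mult[OF f] ring_extension_sum_list[OF f]
        power2_eq_square o_def)
  moreover have "f d \<noteq> 0"
    using \<open>d \<noteq> 0\<close> by (simp add: ring_extension_eq_0_iff[OF f])
  ultimately show "a \<in> f -` I"
    using I \<open>i \<in> f -` I\<close> unfolding central_ideal_iff by blast
qed

text \<open>With the smaller domain identified with its image, the preimage under \<open>f\<close>
  is the contraction of an ideal; the map on central primes combines the two preimage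
  results.\<close>

theorem proposition4p1:
  fixes f :: "'a::idom \<Rightarrow> 'b::idom"
  assumes "ring_extension f"
    and "\<exists>h :: rat \<Rightarrow> 'a. ring_extension h"
    and "\<exists>h :: rat \<Rightarrow> 'b. ring_extension h"
  shows "(\<forall>I :: 'b set. central_ideal I \<longrightarrow> central_ideal (f -` I)) \<and>
         (\<lambda>q. f -` q) \<in> (C_Spec :: 'b set set) \<rightarrow> (C_Spec :: 'a set set)"
  using central_ideal_vimage[OF assms(1)] primeideal_vimage_ring_extension[OF assms(1)]
  by (auto simp: C_Spec_def)

end
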